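(* Let $r$ be a positive integer. Then \[ \sum_{k = 0}^{\infty } {\frac{1}{{\alpha ^{4rk} }}\left( {\frac{{2\beta ^r }}{{4k + 1}} - \frac{{2\beta ^{3r} }}{{4k + 3}}} \right)} = \begin{cases} - \arctan \left( \dfrac{2}{L_r } \right), & r \text{ odd}, \\[2mm] \arctan \left( \dfrac{2}{F_r \sqrt 5 } \right), & r \text{ even}. \end{cases} \]
   Context: $\alpha=(1+\sqrt5)/2$ is the golden ratio and $\beta=-1/\alpha=(1-\sqrt5)/2$. The Fibonacci and Lucas numbers are $F_n=(\alpha^n-\beta^n)/\sqrt5$ and $L_n=\alpha^n+\beta^n$. *)

theory Defs
  imports "HOL-Analysis.Analysis" "HOL-Number_Theory.Fib"
begin

definition golden :: real where
  "golden = (1 + sqrt 5) / 2"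

definition golden_conj :: real where
  "golden_conj = (1 - sqrt 5) / 2"

lemma golden_conj_eq: "golden_conj = - 1 / golden"
proof -
  have "golden > 0"
    unfolding golden_def by (simp add: add_pos_nonneg)
  moreover have "golden_conj * golden = - 1"
    by (simp add: golden_def golden_conj_def field_simps)
  ultimately show ?thesis
    by (simp add: field_simps)
qed

text \<open>The Binet formula identifies the library function \<open>fib\<close> with
  the numbers \<open>F\<^sub>n\<close>.\<close>

lemma fib_Binet: "real (fib n) = (golden ^ n - golden_conj ^ n) / sqrt 5"
  unfolding golden_def golden_conj_def by (rule fib_closed_form)

definition lucas_num :: "nat \<Rightarrow> real" where
  "lucas_num n = golden ^ n + golden_conj ^ n"

end

theory Submission
  imports Defs
begin

text \<open>For \<open>x = \<beta>\<^sup>r\<close> the series is twice the arctangent series of \<open>x\<close> with consecutive terms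
  paired, since \<open>1 / \<alpha>\<^bsup>4rk\<^esup> = x\<^bsup>4k\<^esup>\<close>. Its value \<open>2 arctan x = arctan (2x / (1 - x\<^sup>2))\<close> is
  evaluated using \<open>\<alpha>\<^sup>r x = (-1)\<^sup>r\<close>.\<close>

lemma golden_mult_golden_conj: "golden * golden_conj = - 1"
  by (simp add: golden_def golden_conj_def field_simps)

lemma golden_power_mult_golden_conj_power: "golden ^ n * golden_conj ^ n = (- 1) ^ n"
  by (simp flip: power_mult_distrib add: golden_mult_golden_conj)

text \<open>The strict bound passes to \<open>golden_conj ^ r\<close> for \<open>r > 0\<close>, as
  the double-angle formula for arctan demands.\<close>

lemma abs_golden_conj_less_1: "\<bar>golden_conj\<bar> < 1"
proof -
  have "1 < sqrt 5" "sqrt 5 < 3"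
    by (simp_all add: real_less_lsqrt)
  then show ?thesis
    by (simp add: golden_conj_def abs_less_iff)
qed

lemma arctan_sums:
  fixes x :: real
  assumes "\<bar>x\<bar> \<le> 1"
  shows "(\<lambda>k. (- 1) ^ k * (1 / real (k * 2 + 1) * x ^ (k * 2 + 1))) sums arctan x"
  using summable_sums[OF summable_arctan_series[OF assms]]
  unfolding arctan_series[OF assms, symmetric] .

text \<open>Grouping a convergent series into blocks of two keeps its sum. In each block the even
  index contributes the positive term and the odd index the negative one.\<close>

lemma arctan_sums_paired:
  fixes x :: real
  assumes "\<bar>x\<bar> \<le> 1"
  shows "(\<lambda>k. x ^ (4 * k) * (x / (4 * real k + 1) - x ^ 3 / (4 * real k + 3))) sums arctan x"
proof -
  let ?f = "\<lambda>k. (- 1) ^ k * (1 / real (k * 2 + 1) * x ^ (k * 2 + 1))"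
  have "sum ?f {n * 2..<n * 2 + 2} =
      x ^ (4 * n) * (x / (4 * real n + 1) - x ^ 3 / (4 * real n + 3))" for n
  proof -
    have "{n * 2..<n * 2 + 2} = {2 * n, Suc (2 * n)}"
      by auto
    then have "sum ?f {n * 2..<n * 2 + 2} = ?f (2 * n) + ?f (Suc (2 * n))"
      by simp
    also have "?f (2 * n) = x ^ (4 * n) * (x / (4 * real n + 1))"
      by (simp add: mult.commute)
    also have "?f (Suc (2 * n)) = - (x ^ (4 * n) * (x ^ 3 / (4 * real n + 3)))"
      by (simp add: power_add mult.commute power3_eq_cube add.commute)
    finally show ?thesis
      by (simp add: right_diff_distrib)
  qed
  then show ?thesis
    using sums_group[OF arctan_sums[OF assms], of 2] by simp
qed

theorem theorem3p8:
  fixes r :: nat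
  assumes "r > 0"
  shows "(\<lambda>k::nat. 1 / golden ^ (4 * r * k) *
            (2 * golden_conj ^ r / (4 * real k + 1) - 2 * golden_conj ^ (3 * r) / (4 * real k + 3)))
         sums (if odd r then - arctan (2 / lucas_num r)
               else arctan (2 / (real (fib r) * sqrt 5)))"
proof -
  define x where "x = golden_conj ^ r"
  have x: "\<bar>x\<bar> < 1"
    using abs_golden_conj_less_1 assms by (simp add: x_def power_abs power_less_one_iff)
  have gx: "golden ^ r * x = (- 1) ^ r"
    by (simp add: x_def golden_power_mult_golden_conj_power)
  then have x0: "x \<noteq> 0"
    by auto
  have x3: "golden_conj ^ (3 * r) = x ^ 3"
    by (simp add: x_def mult.commute flip: power_mult)
  \<comment> \<open>The exponent \<open>4 * k\<close> is even, so the sign in \<open>gx\<close>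
    disappears for either parity of \<open>r\<close>.\<close>
  have pow: "1 / golden ^ (4 * r * k) = x ^ (4 * k)" for k
  proof -
    have "golden ^ (4 * r * k) * x ^ (4 * k) = (golden ^ r * x) ^ (4 * k)"
      by (simp add: power_mult_distrib mult.commute mult.left_commute flip: power_mult)
    also have "\<dots> = 1"
      by (simp add: gx flip: power_mult)
    finally show ?thesis
      by (metis mult_zero_left nonzero_eq_divide_eq mult.commute zero_neq_one)
  qed
  \<comment> \<open>Since |x| < 1, the angle \<open>2 * arctan x\<close> stays within (-pi/2, pi/2),
    the range of arctan.\<close>
  have "2 * arctan x = arctan (2 * x / (1 - x\<^sup>2))"
    using x by (rule arctan_double)
  also have "\<dots> = (if odd r then - arctan (2 / lucas_num r)
               else arctan (2 / (real (fib r) * sqrt 5)))"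
  proof (cases "odd r")
    case True
    then have g: "golden ^ r = - 1 / x"
      using gx x0 by (simp add: field_simps)
    \<comment> \<open>Here L_r = x - 1/x, so 2x / (1 - x^2) = -2 / L_r; oddness of arctan moves the
      sign outside.\<close>
    have "lucas_num r = - ((1 - x\<^sup>2) / x)"
      using x0 by (simp add: lucas_num_def g flip: x_def) (simp add: field_simps power2_eq_square)
    then show ?thesis
      using True by (simp add: arctan_minus)
  next
    case False
    then have g: "golden ^ r = 1 / x"
      using gx x0 by (simp add: field_simps)
    \<comment> \<open>By Binet the left side is 1/x - x, whose reciprocal doubled is the
      double-angle argument.\<close>
    have "real (fib r) * sqrt 5 = (1 - x\<^sup>2) / x"
      using x0 by (simp add: fib_Binet g flip: x_def) (simp add: field_simps power2_eq_square)
    then show ?thesis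
      using False by simp
  qed
  finally have "(\<lambda>k. 2 * (x ^ (4 * k) * (x / (4 * real k + 1) - x ^ 3 / (4 * real k + 3)))) sums
      (if odd r then - arctan (2 / lucas_num r) else arctan (2 / (real (fib r) * sqrt 5)))"
    using sums_mult[OF arctan_sums_paired[of x], of 2] x by simp
  moreover have "1 / golden ^ (4 * r * k) *
        (2 * golden_conj ^ r / (4 * real k + 1) - 2 * golden_conj ^ (3 * r) / (4 * real k + 3)) =
      2 * (x ^ (4 * k) * (x / (4 * real k + 1) - x ^ 3 / (4 * real k + 3)))" for k
  proof -
    \<comment> \<open>Stated for arbitrary reals so that powers and denominators act as atoms when
      the factor 2 is pulled out.\<close>
    have "p * (2 * x / c - 2 * y / d) = 2 * (p * (x / c - y / d))" for p y c d :: real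
      by (simp only: times_divide_eq_right right_diff_distrib mult.left_commute)
    then show ?thesis
      unfolding pow x3 x_def[symmetric] .
  qed
  ultimately show ?thesis
    by simp
qed

end
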